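(* There exists a universal constant $c>0$ such that for every natural number $n\ge2$ there exists a bipartite quantum probability distribution $P$ with $\big[2^{\frac{\log^2n}{2}}\big]^n$ inputs per site, $n+1$ outputs per site, and Hilbert spaces $H_1,H_2$ each of dimension $n$, such that $$\nu(P)\ \ge\ c\,\frac{\sqrt n}{\log^2n}.$$
   Context: $\log$ denotes the logarithm in base $2$. For a real number $x$, $[x]$ denotes the smallest natural number $p$ with $x\le p$. Fix $N$ (number of inputs per site) and $K$ (number of outputs per site). Consider families $P=(P(a,b|x,y))$, $x,y\in\{1,\dots,N\}$, $a,b\in\{1,\dots,K\}$. $P$ is classical ($P\in\mathcal{L}$) if $P(a,b|x,y)=\int_\Omega P_\omega(a|x)Q_\omega(b|y)\,d\mathbb{P}(\omega)$ for all $x,y,a,b$, where $(\Omega,\mathbb{P})$ is a probability space, $P_\omega(a|x)\ge0$, $\sum_aP_\omega(a|x)=1$ for all $x,\omega$, and analogously for $Q_\omega(b|y)$. $P$ is quantum, with Hilbert spaces $H_1,H_2$, if $P(a,b|x,y)=\mathrm{tr}\big((E_x^a\otimes F_y^b)\rho\big)$ for all $x,y,a,b$, where $\rho$ is a density operator on $H_1\otimes H_2$, $E_x^a\in B(H_1)$ and $F_y^b\in B(H_2)$ are positive semidefinite operators, $\sum_aE_x^a=\mathbb{1}$ for every $x$ and $\sum_bF_y^b=\mathbb{1}$ for every $y$. For a real family $M=(M_{x,y}^{a,b})$ put $\langle M,P\rangle=\sum_{x,y,a,b}M_{x,y}^{a,b}P(a,b|x,y)$, and define $$\nu(P)=\sup\{\langle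 M,P\rangle:\ |\langle M,P'\rangle|\le1\ \text{for every }P'\in\mathcal{L}\},$$ where $\mathcal{L}$ is taken with the same numbers of inputs and outputs as $P$. *)

theory Defs
  imports "HOL-Probability.Probability" "Jordan_Normal_Form.Matrix"
begin

definition least_nat_above :: "real \<Rightarrow> nat" where
  "least_nat_above x = (LEAST p. x \<le> real p)"

text \<open>
  A family with \<open>N\<close> inputs and \<open>K\<close> outputs per site is a function \<open>P\<close> with \<open>P a b x y\<close>
  standing for \<open>P(a,b|x,y)\<close>; only the values for \<open>a, b \<in> {1..K}\<close> and \<open>x, y \<in> {1..N}\<close> matter.
\<close>

type_synonym family = "nat \<Rightarrow> nat \<Rightarrow> nat \<Rightarrow> nat \<Rightarrow> real"

definition response :: "'w measure \<Rightarrow> nat \<Rightarrow> nat \<Rightarrow> ('w \<Rightarrow> nat \<Rightarrow> nat \<Rightarrow> real) \<Rightarrow> bool" where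
  "response W N K p \<longleftrightarrow>
     (\<forall>x\<in>{1..N}. \<forall>a\<in>{1..K}. (\<lambda>\<omega>. p \<omega> a x) \<in> borel_measurable W) \<and>
     (\<forall>\<omega>\<in>space W. \<forall>x\<in>{1..N}. (\<forall>a\<in>{1..K}. 0 \<le> p \<omega> a x) \<and> (\<Sum>a\<in>{1..K}. p \<omega> a x) = 1)"

definition classical_on :: "'w measure \<Rightarrow> nat \<Rightarrow> nat \<Rightarrow> family \<Rightarrow> bool" where
  "classical_on W N K P \<longleftrightarrow> prob_space W \<and>
     (\<exists>p q. response W N K p \<and> response W N K q \<and>
        (\<forall>x\<in>{1..N}. \<forall>y\<in>{1..N}. \<forall>a\<in>{1..K}. \<forall>b\<in>{1..K}.
           P a b x y = (\<integral>\<omega>. p \<omega> a x * q \<omega> b y \<partial>W)))"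

text \<open>
  HOL cannot quantify over the type carrying the probability space, so the set of classical
  families uses the type of pairs of response functions. Lemma \<open>classical_onD\<close> below shows that
  this loses nothing: a family that is classical over a probability space on any type is in it.
\<close>

definition classical :: "nat \<Rightarrow> nat \<Rightarrow> family set" where
  "classical N K =
     {P. \<exists>W :: ((nat \<Rightarrow> nat \<Rightarrow> real) \<times> (nat \<Rightarrow> nat \<Rightarrow> real)) measure. classical_on W N K P}"

lemma classical_onD:
  fixes W :: "'w measure"
  assumes "classical_on W N K P"
  shows "P \<in> classical N K"
proof -
  obtain p q where W: "prob_space W" and p: "response W N K p" and q: "response W N K q"
    and P: "\<And>x y a b. \<lbrakk>x \<in> {1..N}; y \<in> {1..N}; a \<in> {1..K}; b \<in> {1..K}\<rbrakk> \<Longrightarrow>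
              P a b x y = (\<integral>\<omega>. p \<omega> a x * q \<omega> b y \<partial>W)"
    using assms unfolding classical_on_def by blast
  define cut :: "('w \<Rightarrow> nat \<Rightarrow> nat \<Rightarrow> real) \<Rightarrow> 'w \<Rightarrow> nat \<Rightarrow> nat \<Rightarrow> real"
    where "cut r \<omega> = (\<lambda>a x. if a \<in> {1..K} \<and> x \<in> {1..N} then r \<omega> a x else 0)" for r \<omega>
  define f where "f \<omega> = (cut p \<omega>, cut q \<omega>)" for \<omega>
  define R where "R = restrict_space borel (f ` space W)"
  define V where "V = distr W R f"
  have cut_meas: "cut r \<in> borel_measurable W" if "response W N K r" for r
  proof (intro measurable_coordinatewise_then_product)
    fix a x
    show "(\<lambda>\<omega>. cut r \<omega> a x) \<in> borel_measurable W"
      using that unfolding response_def cut_def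
      by (cases "a \<in> {1..K} \<and> x \<in> {1..N}") auto
  qed
  have f_borel: "f \<in> borel_measurable W"
    unfolding f_def[abs_def] by (intro borel_measurable_Pair cut_meas p q)
  then have f: "f \<in> W \<rightarrow>\<^sub>M R"
    unfolding R_def by (intro measurable_restrict_space2) auto
  have spV: "space V = f ` space W"
    unfolding V_def R_def by (simp add: space_restrict_space)
  have coord: "(\<lambda>r :: nat \<Rightarrow> nat \<Rightarrow> real. r a x) \<in> borel_measurable borel" for a x
    by (rule measurable_product_then_coordinatewise
        [OF measurable_product_coordinates])
  have fst_meas: "(\<lambda>r. fst r a x) \<in> borel_measurable R"
    and snd_meas: "(\<lambda>r. snd r a x) \<in> borel_measurable R" for a x
    unfolding R_def
    by (intro measurable_restrict_space1 measurable_compose[OF _ coord]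
        borel_measurable_continuous_onI continuous_intros)+
  have "response V N K fst"
    unfolding response_def
  proof (intro conjI ballI)
    show "(\<lambda>r. fst r a x) \<in> borel_measurable V" for a x
      using fst_meas unfolding V_def by simp
  qed (use p in \<open>auto simp: spV f_def cut_def response_def\<close>)
  moreover have "response V N K snd"
    unfolding response_def
  proof (intro conjI ballI)
    show "(\<lambda>r. snd r a x) \<in> borel_measurable V" for a x
      using snd_meas unfolding V_def by simp
  qed (use q in \<open>auto simp: spV f_def cut_def response_def\<close>)
  moreover have "P a b x y = (\<integral>r. fst r a x * snd r b y \<partial>V)"
    if "x \<in> {1..N}" "y \<in> {1..N}" "a \<in> {1..K}" "b \<in> {1..K}" for x y a b
  proof -
    have "(\<integral>r. fst r a x * snd r b y \<partial>V) = (\<integral>\<omega>. fst (f \<omega>) a x * snd (f \<omega>) b y \<partial>W)"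
      unfolding V_def by (intro integral_distr f borel_measurable_times fst_meas snd_meas)
    also have "\<dots> = (\<integral>\<omega>. p \<omega> a x * q \<omega> b y \<partial>W)"
      using that by (simp add: f_def cut_def)
    finally show ?thesis using P[OF that] by simp
  qed
  moreover have "prob_space V"
    unfolding V_def by (rule prob_space.prob_space_distr[OF W f])
  ultimately show ?thesis
    unfolding classical_def classical_on_def by blast
qed

text \<open>
  A Hilbert space of dimension \<open>d\<close> is \<open>\<complex>\<^sup>d\<close>, its operators are the complex \<open>d \<times> d\<close> matrices, and
  the tensor product of operators is the Kronecker product. In the order on the complex numbers
  \<open>0 \<le> z\<close> means that \<open>z\<close> is real and nonnegative, so \<open>psd\<close> matrices are Hermitian.
\<close>

definition psd :: "nat \<Rightarrow> complex mat \<Rightarrow> bool" where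
  "psd d A \<longleftrightarrow> A \<in> carrier_mat d d \<and> (\<forall>v\<in>carrier_vec d. 0 \<le> (A *\<^sub>v v) \<bullet>c v)"

definition mat_trace :: "complex mat \<Rightarrow> complex" where
  "mat_trace A = (\<Sum>i<dim_row A. A $$ (i, i))"

definition kronecker :: "complex mat \<Rightarrow> complex mat \<Rightarrow> complex mat" where
  "kronecker A B = mat (dim_row A * dim_row B) (dim_col A * dim_col B)
     (\<lambda>(i, j). A $$ (i div dim_row B, j div dim_col B) * B $$ (i mod dim_row B, j mod dim_col B))"

definition density_operator :: "nat \<Rightarrow> complex mat \<Rightarrow> bool" where
  "density_operator d \<rho> \<longleftrightarrow> psd d \<rho> \<and> mat_trace \<rho> = 1"

definition povm :: "nat \<Rightarrow> nat \<Rightarrow> (nat \<Rightarrow> complex mat) \<Rightarrow> bool" where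
  "povm d K E \<longleftrightarrow> (\<forall>a\<in>{1..K}. psd d (E a)) \<and>
     finsum (module_mat TYPE(complex) d d) E {1..K} = 1\<^sub>m d"

definition quantum :: "nat \<Rightarrow> nat \<Rightarrow> nat \<Rightarrow> nat \<Rightarrow> family \<Rightarrow> bool" where
  "quantum d1 d2 N K P \<longleftrightarrow>
     (\<exists>\<rho> E F. density_operator (d1 * d2) \<rho> \<and>
        (\<forall>x\<in>{1..N}. povm d1 K (E x)) \<and> (\<forall>y\<in>{1..N}. povm d2 K (F y)) \<and>
        (\<forall>x\<in>{1..N}. \<forall>y\<in>{1..N}. \<forall>a\<in>{1..K}. \<forall>b\<in>{1..K}.
           complex_of_real (P a b x y) = mat_trace (kronecker (E x a) (F y b) * \<rho>)))"

definition pairing :: "nat \<Rightarrow> nat \<Rightarrow> family \<Rightarrow> family \<Rightarrow> real" where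
  "pairing N K M P =
     (\<Sum>x\<in>{1..N}. \<Sum>y\<in>{1..N}. \<Sum>a\<in>{1..K}. \<Sum>b\<in>{1..K}. M a b x y * P a b x y)"

text \<open>
  The supremum is taken in the extended reals: for a family outside the linear span of the
  classical ones it is infinite.
\<close>

definition nu :: "nat \<Rightarrow> nat \<Rightarrow> family \<Rightarrow> ereal" where
  "nu N K P = (SUP M\<in>{M. \<forall>P'\<in>classical N K. \<bar>pairing N K M P'\<bar> \<le> 1}. ereal (pairing N K M P))"

end

theory Submission
  imports Defs
begin

text \<open>
  The violation comes from a game in the style of Khot and Vishnoi with constant noise. Let \<open>m\<close> be the
  largest power of two with \<open>m \<le> n\<close>. An input is a sign vector of length \<open>m\<close>, encoded as a subset of
  \<open>{..<m}\<close>, and an output \<open>a \<le> m\<close> multiplies it by row \<open>a\<close> of a Hadamard matrix. The functional weighs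
  the two resulting sign vectors \<open>u, v\<close> by the noise kernel \<open>\<Sum>\<^sub>S 3\<^bsup>-|S|\<^esup> \<chi>\<^sub>S(u) \<chi>\<^sub>S(v)\<close>.
  A classical strategy of one site becomes a function on the cube with values in \<open>[0, m]\<close> and mean at
  most \<open>1\<close>, and the hypercontractive inequality from \<open>L\<^sup>2\<close> to \<open>L\<^sup>4\<close> bounds the classical value by \<open>\<surd>m\<close>.
  Measuring a maximally entangled state in the bases of normalized sign vectors gives the distribution
  \<open>\<langle>u, v\<rangle>\<^sup>2 / m\<^sup>3\<close>, whose Fourier weight sits in degree at most \<open>2\<close>, hence its value is at least \<open>m / 9\<close>.
  The ratio \<open>\<surd>m / 9\<close> exceeds \<open>\<surd>n / 18\<close>.
\<close>

subsection \<open>Walsh functions and hypercontractivity\<close>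

text \<open>The character of \<open>S\<close> on the cube, a sign vector being encoded as the set
  \<open>X\<close> of its coordinates equal to -1. Symmetric difference of sets is then
  multiplication of sign vectors.\<close>

definition walsh :: "'a set \<Rightarrow> 'a set \<Rightarrow> real" where
  "walsh S X = (\<Prod>i\<in>S. if i \<in> X then - 1 else 1)"

lemma walsh_empty [simp]: "walsh {} X = 1"
  by (simp add: walsh_def)

lemma walsh_insert:
  "\<lbrakk>finite S; i \<notin> S\<rbrakk> \<Longrightarrow> walsh (insert i S) X = (if i \<in> X then - walsh S X else walsh S X)"
  by (simp add: walsh_def)

lemma walsh_singleton: "walsh {i} X = (if i \<in> X then - 1 else 1)"
  by (simp add: walsh_def)

lemma walsh_insert_right: "i \<notin> S \<Longrightarrow> walsh S (insert i X) = walsh S X"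
  unfolding walsh_def by (intro prod.cong) auto

lemma walsh_square [simp]: "(walsh S X)\<^sup>2 = 1"
  unfolding walsh_def prod_power_distrib by (intro prod.neutral) auto

lemma walsh_self [simp]: "walsh S X * walsh S X = 1"
  using walsh_square[of S X] by (simp add: power2_eq_square)

lemma walsh_cases: "walsh S X = 1 \<or> walsh S X = - 1"
  using walsh_square[of S X] unfolding power2_eq_1_iff .

lemma walsh_sym_diff: "walsh S (sym_diff X Y) = walsh S X * walsh S Y"
  unfolding walsh_def prod.distrib[symmetric] by (intro prod.cong) auto

text \<open>The product of two characters factors over the coordinates, so the sum over the cube is
  a product of factors \<open>e i + 1\<close>. One of them vanishes as soon as a coordinate lies in
  exactly one of \<open>S\<close> and \<open>T\<close>.\<close>

lemma walsh_orthogonal: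
  assumes A: "finite A" and S: "S \<subseteq> A" and T: "T \<subseteq> A"
  shows "(\<Sum>X\<in>Pow A. walsh S X * walsh T X) = (if S = T then 2 ^ card A else 0)"
proof -
  define e where "e i = (if i \<in> S then - 1 else 1) * (if i \<in> T then - 1 else (1::real))" for i
  have *: "walsh S X = (\<Prod>i\<in>X. if i \<in> S then - 1 else 1)"
    if "S \<subseteq> A" "X \<in> Pow A" for S X
  proof -
    have "walsh S X = (\<Prod>i\<in>S \<inter> X. - 1)"
      using A that finite_subset unfolding walsh_def
      by (subst prod.inter_restrict) (auto intro: finite_subset)
    also have "\<dots> = (\<Prod>i\<in>X. if i \<in> S then - 1 else 1)"
      using A that by (subst Int_commute, subst prod.inter_restrict) (auto intro: finite_subset)
    finally show ?thesis .
  qed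
  have "(\<Sum>X\<in>Pow A. walsh S X * walsh T X) = (\<Sum>X\<in>Pow A. (\<Prod>i\<in>X. e i) * (\<Prod>i\<in>A - X. 1))"
    by (intro sum.cong) (simp_all add: *[OF S] *[OF T] e_def prod.distrib)
  also have "\<dots> = (\<Prod>i\<in>A. e i + 1)"
    by (rule prod_add[OF A, symmetric])
  also have "\<dots> = (if S = T then 2 ^ card A else 0)"
  proof (cases "S = T")
    case True
    have "(\<Prod>i\<in>A. e i + 1) = (\<Prod>i\<in>A. 2)"
      by (intro prod.cong) (auto simp: e_def True)
    then show ?thesis using True by simp
  next
    case False
    then obtain i where "i \<in> A" "i \<in> S \<longleftrightarrow> i \<notin> T"
      using S T by blast
    then have "i \<in> A" "e i + 1 = 0"
      unfolding e_def by auto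
    then show ?thesis using False A by (auto intro!: prod_zero)
  qed
  finally show ?thesis .
qed

lemma sum_Pow_insert:
  fixes g :: "'a set \<Rightarrow> 'b::comm_monoid_add"
  assumes "finite A" "i \<notin> A"
  shows "(\<Sum>X\<in>Pow (insert i A). g X) = (\<Sum>X\<in>Pow A. g X) + (\<Sum>X\<in>Pow A. g (insert i X))"
proof -
  have inj: "inj_on (insert i) (Pow A)"
    using assms(2) by (intro inj_onI) (metis Pow_iff insert_ident subsetD)
  show ?thesis
    unfolding Pow_insert using assms
    by (subst sum.union_disjoint) (auto simp: sum.reindex[OF inj])
qed

text \<open>
  With \<open>a\<close> and \<open>b\<close> the restrictions of the polynomial to the monomials without and with \<open>i\<close>, the
  induction step rests on \<open>(a + b)^4 + (a - b)^4 = 2 (a^4 + 6 a\<^sup>2 b\<^sup>2 + b^4)\<close> and Cauchy--Schwarz.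
\<close>

lemma bonami_inequality:
  assumes "finite A"
  shows "(\<Sum>X\<in>Pow A. (\<Sum>S\<in>Pow A. c S * walsh S X) ^ 4) \<le>
           2 ^ card A * (\<Sum>S\<in>Pow A. 3 ^ card S * (c S)\<^sup>2)\<^sup>2"
  using assms
proof (induction A arbitrary: c rule: finite_induct)
  case empty
  show ?case by simp
next
  case (insert i A)
  define a where "a X = (\<Sum>S\<in>Pow A. c S * walsh S X)" for X
  define b where "b X = (\<Sum>S\<in>Pow A. c (insert i S) * walsh S X)" for X
  define U where "U = (\<Sum>S\<in>Pow A. 3 ^ card S * (c S)\<^sup>2)"
  define V where "V = (\<Sum>S\<in>Pow A. 3 ^ card S * (c (insert i S))\<^sup>2)"
  have fin: "finite S" "i \<notin> S" if "S \<in> Pow A" for S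
    using that insert.hyps finite_subset by auto
  have nonneg: "0 \<le> U" "0 \<le> V"
    unfolding U_def V_def by (auto intro!: sum_nonneg)
  have a4: "(\<Sum>X\<in>Pow A. a X ^ 4) \<le> 2 ^ card A * U\<^sup>2"
    unfolding a_def U_def by (rule insert.IH)
  have b4: "(\<Sum>X\<in>Pow A. b X ^ 4) \<le> 2 ^ card A * V\<^sup>2"
    unfolding b_def V_def by (rule insert.IH)
  have ab: "(\<Sum>X\<in>Pow A. (a X)\<^sup>2 * (b X)\<^sup>2) \<le> 2 ^ card A * (U * V)"
  proof (rule power2_le_imp_le)
    have "(\<Sum>X\<in>Pow A. (a X)\<^sup>2 * (b X)\<^sup>2)\<^sup>2 \<le> (\<Sum>X\<in>Pow A. a X ^ 4) * (\<Sum>X\<in>Pow A. b X ^ 4)"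
      using Cauchy_Schwarz_ineq_sum[of "\<lambda>X. (a X)\<^sup>2" "\<lambda>X. (b X)\<^sup>2" "Pow A"]
      by (simp flip: power_mult)
    also have "\<dots> \<le> (2 ^ card A * U\<^sup>2) * (2 ^ card A * V\<^sup>2)"
      by (intro mult_mono a4 b4) (auto intro!: sum_nonneg)
    finally show "(\<Sum>X\<in>Pow A. (a X)\<^sup>2 * (b X)\<^sup>2)\<^sup>2 \<le> (2 ^ card A * (U * V))\<^sup>2"
      by (simp add: power2_eq_square algebra_simps)
  qed (use nonneg in auto)
  have val: "(\<Sum>S\<in>Pow (insert i A). c S * walsh S X) = a X + b X * walsh {i} X" for X
    unfolding sum_Pow_insert[OF insert.hyps] a_def b_def sum_distrib_right
    using fin by (auto intro!: sum.cong simp: walsh_insert walsh_singleton)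
  have shift: "a (insert i X) = a X" "b (insert i X) = b X" for X
    unfolding a_def b_def using fin by (auto intro!: sum.cong simp: walsh_insert_right)
  have weight: "(\<Sum>S\<in>Pow (insert i A). 3 ^ card S * (c S)\<^sup>2) = U + 3 * V"
    unfolding sum_Pow_insert[OF insert.hyps] U_def V_def sum_distrib_left
    using fin by (auto intro!: sum.cong)
  have "(\<Sum>X\<in>Pow (insert i A). (\<Sum>S\<in>Pow (insert i A). c S * walsh S X) ^ 4) =
          (\<Sum>X\<in>Pow A. (a X + b X) ^ 4 + (a X - b X) ^ 4)"
    unfolding val sum_Pow_insert[OF insert.hyps] sum.distrib
    using fin by (auto intro!: sum.cong simp: walsh_singleton shift)
  also have "\<dots> = (\<Sum>X\<in>Pow A. 2 * a X ^ 4 + 12 * ((a X)\<^sup>2 * (b X)\<^sup>2) + 2 * b X ^ 4)"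
    by (intro sum.cong refl) (simp add: power4_eq_xxxx power2_eq_square algebra_simps)
  also have "\<dots> = 2 * (\<Sum>X\<in>Pow A. a X ^ 4) + 12 * (\<Sum>X\<in>Pow A. (a X)\<^sup>2 * (b X)\<^sup>2) +
                   2 * (\<Sum>X\<in>Pow A. b X ^ 4)"
    by (simp add: sum.distrib sum_distrib_left)
  also have "\<dots> \<le> 2 * (2 ^ card A * U\<^sup>2) + 12 * (2 ^ card A * (U * V)) + 2 * (2 ^ card A * V\<^sup>2)"
    using a4 ab b4 by linarith
  \<comment> \<open>Up to the factor \<open>2 * 2 ^ card A\<close>, this compares U^2 + 6UV + V^2
    with U^2 + 6UV + 9V^2: the weight 3 per degree is exactly what the mixed term requires.\<close>
  also have "\<dots> \<le> 2 ^ card (insert i A) * (U + 3 * V)\<^sup>2"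
    using insert.hyps nonneg by (simp add: power2_eq_square algebra_simps)
  finally show ?case unfolding weight .
qed

section \<open>Fourier coefficients and the noise bound\<close>

definition fourier :: "'a set \<Rightarrow> ('a set \<Rightarrow> real) \<Rightarrow> 'a set \<Rightarrow> real" where
  "fourier A f S = (\<Sum>X\<in>Pow A. f X * walsh S X) / 2 ^ card A"

lemma sum_mult_walsh: "(\<Sum>X\<in>Pow A. f X * walsh S X) = 2 ^ card A * fourier A f S"
  by (simp add: fourier_def)

text \<open>
  The sum \<open>W\<close> bounded here is the mean of \<open>f k\<close> for the noisy copy \<open>k\<close> of \<open>f\<close>. Two applications of
  Cauchy--Schwarz bound \<open>W^4\<close> by \<open>L\<close> times the mean of \<open>k^4\<close>, which Bonami's inequality bounds by \<open>W\<^sup>2\<close>.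
\<close>

lemma fourier_noise_bound:
  assumes A: "finite A" and f0: "\<And>X. X \<subseteq> A \<Longrightarrow> 0 \<le> f X" and fL: "\<And>X. X \<subseteq> A \<Longrightarrow> f X \<le> L"
    and mean: "(\<Sum>X\<in>Pow A. f X) \<le> 2 ^ card A"
  shows "(\<Sum>S\<in>Pow A. (fourier A f S)\<^sup>2 / 3 ^ card S) \<le> sqrt L"
proof -
  define W where "W = (\<Sum>S\<in>Pow A. (fourier A f S)\<^sup>2 / 3 ^ card S)"
  define k where "k X = (\<Sum>S\<in>Pow A. fourier A f S / 3 ^ card S * walsh S X)" for X
  define n where "n = (2::real) ^ card A"
  have n: "n > 0" unfolding n_def by simp
  have W0: "0 \<le> W" unfolding W_def by (auto intro!: sum_nonneg)
  have L0: "0 \<le> L" using f0[of "{}"] fL[of "{}"] by simp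
  have k4: "(\<Sum>X\<in>Pow A. k X ^ 4) \<le> n * W\<^sup>2"
  proof -
    \<comment> \<open>The weight in Bonami's inequality cancels one of the two damping factors, so
      its right-hand side is again expressed by \<open>W\<close>.\<close>
    have "(\<Sum>S\<in>Pow A. 3 ^ card S * (fourier A f S / 3 ^ card S)\<^sup>2) = W"
      unfolding W_def by (intro sum.cong) (auto simp: power2_eq_square field_simps)
    then show ?thesis
      using bonami_inequality[OF A, of "\<lambda>S. fourier A f S / 3 ^ card S"]
      unfolding k_def n_def by simp
  qed
  have fk: "(\<Sum>X\<in>Pow A. f X * k X) = n * W"
  proof -
    have "(\<Sum>X\<in>Pow A. f X * k X) =
            (\<Sum>S\<in>Pow A. \<Sum>X\<in>Pow A. f X * (fourier A f S / 3 ^ card S * walsh S X))"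
      unfolding k_def sum_distrib_left by (rule sum.swap)
    also have "\<dots> = (\<Sum>S\<in>Pow A. fourier A f S / 3 ^ card S * (n * fourier A f S))"
      unfolding n_def sum_mult_walsh[symmetric] sum_distrib_left
      by (intro sum.cong refl) (simp add: mult_ac)
    also have "\<dots> = n * W"
      unfolding W_def sum_distrib_left
      by (intro sum.cong) (auto simp: power2_eq_square field_simps)
    finally show ?thesis .
  qed
  have f2: "(\<Sum>X\<in>Pow A. (f X)\<^sup>2) \<le> L * n"
  proof -
    have "(\<Sum>X\<in>Pow A. (f X)\<^sup>2) \<le> (\<Sum>X\<in>Pow A. L * f X)"
      using f0 fL unfolding power2_eq_square by (intro sum_mono mult_right_mono) auto
    also have "\<dots> \<le> L * n"
      using mean L0 unfolding n_def sum_distrib_left[symmetric] by (rule mult_left_mono)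
    finally show ?thesis .
  qed
  have fkk: "(\<Sum>X\<in>Pow A. f X * (k X)\<^sup>2)\<^sup>2 \<le> (L * n) * (n * W\<^sup>2)"
  proof -
    have "(\<Sum>X\<in>Pow A. f X * (k X)\<^sup>2)\<^sup>2 \<le> (\<Sum>X\<in>Pow A. (f X)\<^sup>2) * (\<Sum>X\<in>Pow A. k X ^ 4)"
      using Cauchy_Schwarz_ineq_sum[of f "\<lambda>X. (k X)\<^sup>2" "Pow A"] by (simp flip: power_mult)
    also have "\<dots> \<le> (L * n) * (n * W\<^sup>2)"
      using L0 n by (intro mult_mono f2 k4) (auto intro!: sum_nonneg)
    finally show ?thesis .
  qed
  \<comment> \<open>\<open>f\<close> serves as a weight: splitting off its square root leaves one
    factor bounded by the mean and another treated in \<open>fkk\<close>.\<close>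
  have "(n * W)\<^sup>2 \<le> n * (\<Sum>X\<in>Pow A. f X * (k X)\<^sup>2)"
  proof -
    have "(n * W)\<^sup>2 = (\<Sum>X\<in>Pow A. sqrt (f X) * (sqrt (f X) * k X))\<^sup>2"
      unfolding fk[symmetric] using f0 by (auto intro!: arg_cong[where f = power2] sum.cong)
    also have "\<dots> \<le> (\<Sum>X\<in>Pow A. (sqrt (f X))\<^sup>2) * (\<Sum>X\<in>Pow A. (sqrt (f X) * k X)\<^sup>2)"
      by (rule Cauchy_Schwarz_ineq_sum)
    also have "\<dots> = (\<Sum>X\<in>Pow A. f X) * (\<Sum>X\<in>Pow A. f X * (k X)\<^sup>2)"
      using f0 by (simp add: power_mult_distrib)
    also have "\<dots> \<le> n * (\<Sum>X\<in>Pow A. f X * (k X)\<^sup>2)"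
      using mean f0 unfolding n_def by (intro mult_right_mono sum_nonneg) auto
    finally show ?thesis .
  qed
  then have "n * W\<^sup>2 \<le> (\<Sum>X\<in>Pow A. f X * (k X)\<^sup>2)"
    using n by (simp add: power2_eq_square mult.assoc mult.left_commute)
  then have "(n * W\<^sup>2)\<^sup>2 \<le> (\<Sum>X\<in>Pow A. f X * (k X)\<^sup>2)\<^sup>2"
    using n by (intro power_mono) auto
  then have "(n * W\<^sup>2)\<^sup>2 \<le> (L * n) * (n * W\<^sup>2)"
    using fkk by linarith
  then have "n\<^sup>2 * (W\<^sup>2 * W\<^sup>2) \<le> n\<^sup>2 * (L * W\<^sup>2)"
    by (simp add: power2_eq_square mult_ac)
  then have "W\<^sup>2 * W\<^sup>2 \<le> L * W\<^sup>2"
    using n by simp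
  \<comment> \<open>For \<open>W = 0\<close> the claim is \<open>0 \<le> L\<close>; otherwise the
    common factor cancels.\<close>
  then have "W\<^sup>2 \<le> L"
    using L0 mult_right_le_imp_le[of "W\<^sup>2" "W\<^sup>2" L] by (cases "W = 0") auto
  then show ?thesis
    unfolding W_def[symmetric] by (rule real_le_rsqrt)
qed

subsection \<open>The noise functional\<close>

text \<open>For finite \<open>A\<close> this is the product over the coordinates of 1 + x_i y_i / 3
  for the two sign vectors: the kernel, with respect to uniform probability, of the operator damping
  degree d by 3^-d.\<close>

definition noise_kernel :: "'a set \<Rightarrow> 'a set \<Rightarrow> 'a set \<Rightarrow> real" where
  "noise_kernel A X Y = (\<Sum>S\<in>Pow A. walsh S X * walsh S Y / 3 ^ card S)"

text \<open>The kernel is diagonal in the Walsh basis. Undoing the normalization in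
  \<open>fourier\<close> costs \<open>2 ^ card A\<close> per site.\<close>

lemma sum_noise_kernel:
  assumes "finite A"
  shows "(\<Sum>X\<in>Pow A. \<Sum>Y\<in>Pow A. noise_kernel A X Y * (f X * g Y)) =
           4 ^ card A * (\<Sum>S\<in>Pow A. fourier A f S * fourier A g S / 3 ^ card S)"
proof -
  have "(\<Sum>X\<in>Pow A. \<Sum>Y\<in>Pow A. noise_kernel A X Y * (f X * g Y)) =
          (\<Sum>X\<in>Pow A. \<Sum>S\<in>Pow A. \<Sum>Y\<in>Pow A. walsh S X * walsh S Y / 3 ^ card S * (f X * g Y))"
    unfolding noise_kernel_def sum_distrib_right by (rule sum.cong[OF refl], rule sum.swap)
  also have "\<dots> = (\<Sum>S\<in>Pow A. \<Sum>X\<in>Pow A. \<Sum>Y\<in>Pow A. walsh S X * walsh S Y / 3 ^ card S * (f X * g Y))"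
    by (rule sum.swap)
  also have "\<dots> = (\<Sum>S\<in>Pow A. (\<Sum>X\<in>Pow A. f X * walsh S X) * (\<Sum>Y\<in>Pow A. g Y * walsh S Y) / 3 ^ card S)"
    unfolding sum_product sum_divide_distrib by (intro sum.cong refl) (simp add: mult_ac)
  also have "\<dots> = 4 ^ card A * (\<Sum>S\<in>Pow A. fourier A f S * fourier A g S / 3 ^ card S)"
    unfolding sum_mult_walsh sum_distrib_left
    by (intro sum.cong refl) (simp flip: power_mult_distrib)
  finally show ?thesis .
qed

section \<open>Absorbing the output shifts, and the two values of the game\<close>

lemma sum_swap_pairs:
  "(\<Sum>x\<in>A. \<Sum>y\<in>B. \<Sum>z\<in>C. \<Sum>w\<in>D. g x y z w) = (\<Sum>z\<in>C. \<Sum>w\<in>D. \<Sum>x\<in>A. \<Sum>y\<in>B. g x y z w)"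
proof -
  have "(\<Sum>x\<in>A. \<Sum>y\<in>B. \<Sum>z\<in>C. \<Sum>w\<in>D. g x y z w) =
          (\<Sum>u\<in>A \<times> B. \<Sum>v\<in>C \<times> D. g (fst u) (snd u) (fst v) (snd v))"
    by (simp add: sum.cartesian_product')
  also have "\<dots> = (\<Sum>v\<in>C \<times> D. \<Sum>u\<in>A \<times> B. g (fst u) (snd u) (fst v) (snd v))"
    by (rule sum.swap)
  also have "\<dots> = (\<Sum>z\<in>C. \<Sum>w\<in>D. \<Sum>x\<in>A. \<Sum>y\<in>B. g x y z w)"
    by (simp add: sum.cartesian_product')
  finally show ?thesis .
qed

lemma sum_Pow_sym_diff:
  assumes "h \<subseteq> A"
  shows "(\<Sum>X\<in>Pow A. g (sym_diff X h)) = (\<Sum>X\<in>Pow A. g X)"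
  by (rule sum.reindex_bij_witness[where i = "\<lambda>X. sym_diff X h" and j = "\<lambda>X. sym_diff X h"])
     (use assms in \<open>auto intro!: arg_cong[where f = g]\<close>)

text \<open>For fixed outputs the shifts permute the cube, so after exchanging the sums they are
  absorbed by the summation over inputs.\<close>

lemma sum_Pow_sym_diff_pairs:
  assumes h: "\<And>a. a \<in> B \<Longrightarrow> h a \<subseteq> A"
  shows "(\<Sum>X\<in>Pow A. \<Sum>Y\<in>Pow A. \<Sum>a\<in>B. \<Sum>b\<in>B. g a b (sym_diff X (h a)) (sym_diff Y (h b))) =
           (\<Sum>a\<in>B. \<Sum>b\<in>B. \<Sum>X\<in>Pow A. \<Sum>Y\<in>Pow A. g a b X Y)"
proof (subst sum_swap_pairs, rule sum.cong[OF refl], rule sum.cong[OF refl])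
  fix a b assume ab: "a \<in> B" "b \<in> B"
  have "(\<Sum>X\<in>Pow A. \<Sum>Y\<in>Pow A. g a b (sym_diff X (h a)) (sym_diff Y (h b))) =
          (\<Sum>X\<in>Pow A. \<Sum>Y\<in>Pow A. g a b (sym_diff X (h a)) Y)"
    by (rule sum.cong[OF refl], rule sum_Pow_sym_diff[OF h[OF ab(2)]])
  also have "\<dots> = (\<Sum>X\<in>Pow A. \<Sum>Y\<in>Pow A. g a b X Y)"
    by (rule sum_Pow_sym_diff[OF h[OF ab(1)]])
  finally show "(\<Sum>X\<in>Pow A. \<Sum>Y\<in>Pow A. g a b (sym_diff X (h a)) (sym_diff Y (h b))) =
                  (\<Sum>X\<in>Pow A. \<Sum>Y\<in>Pow A. g a b X Y)" .
qed

lemma noise_game_classical_bound: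
  fixes p q :: "'b \<Rightarrow> 'a set \<Rightarrow> real"
  assumes A: "finite A" and B: "finite B" and h: "\<And>a. a \<in> B \<Longrightarrow> h a \<subseteq> A"
    and p0: "\<And>a X. a \<in> B \<Longrightarrow> X \<subseteq> A \<Longrightarrow> 0 \<le> p a X" and p1: "\<And>X. X \<subseteq> A \<Longrightarrow> (\<Sum>a\<in>B. p a X) \<le> 1"
    and q0: "\<And>a X. a \<in> B \<Longrightarrow> X \<subseteq> A \<Longrightarrow> 0 \<le> q a X" and q1: "\<And>X. X \<subseteq> A \<Longrightarrow> (\<Sum>a\<in>B. q a X) \<le> 1"
  shows "\<bar>\<Sum>X\<in>Pow A. \<Sum>Y\<in>Pow A. \<Sum>a\<in>B. \<Sum>b\<in>B.
           noise_kernel A (sym_diff X (h a)) (sym_diff Y (h b)) * (p a X * q b Y)\<bar>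
         \<le> 4 ^ card A * sqrt (card B)"
    (is "\<bar>?L\<bar> \<le> _")
proof -
  \<comment> \<open>\<open>F r X\<close> adds up, over all outputs, the probability of answering
    \<open>a\<close> on the one input that \<open>a\<close> carries to \<open>X\<close>.\<close>
  define F where "F r X = (\<Sum>a\<in>B. r a (sym_diff X (h a)))" for r :: "'b \<Rightarrow> 'a set \<Rightarrow> real" and X
  have bound: "(\<Sum>S\<in>Pow A. (fourier A (F r) S)\<^sup>2 / 3 ^ card S) \<le> sqrt (card B)"
    if r0: "\<And>a X. a \<in> B \<Longrightarrow> X \<subseteq> A \<Longrightarrow> 0 \<le> r a X"
      and r1: "\<And>X. X \<subseteq> A \<Longrightarrow> (\<Sum>a\<in>B. r a X) \<le> 1" for r
  proof (rule fourier_noise_bound[OF A])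
    have sub: "sym_diff X (h a) \<subseteq> A" if "X \<subseteq> A" "a \<in> B" for X a
      using h[OF that(2)] that(1) by blast
    have le1: "r a X \<le> 1" if "X \<subseteq> A" "a \<in> B" for X a
      using member_le_sum[of a B "\<lambda>a. r a X"] r0 r1[OF that(1)] B that by fastforce
    show "0 \<le> F r X" if "X \<subseteq> A" for X
      unfolding F_def using r0 sub that by (intro sum_nonneg) auto
    show "F r X \<le> card B" if "X \<subseteq> A" for X
      unfolding F_def using sum_bounded_above[of B _ "1::real"] le1 sub that by fastforce
    have "(\<Sum>X\<in>Pow A. F r X) = (\<Sum>a\<in>B. \<Sum>X\<in>Pow A. r a (sym_diff X (h a)))"
      unfolding F_def by (rule sum.swap)
    also have "\<dots> = (\<Sum>a\<in>B. \<Sum>X\<in>Pow A. r a X)"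
      by (intro sum.cong refl sum_Pow_sym_diff h)
    also have "\<dots> = (\<Sum>X\<in>Pow A. \<Sum>a\<in>B. r a X)"
      by (rule sum.swap)
    also have "\<dots> \<le> 2 ^ card A"
      using sum_bounded_above[of "Pow A" "\<lambda>X. \<Sum>a\<in>B. r a X" 1] r1 A by (simp add: card_Pow)
    finally show "(\<Sum>X\<in>Pow A. F r X) \<le> 2 ^ card A" .
  qed
  have inv: "sym_diff (sym_diff X H) H = X" for X H :: "'a set" by blast
  have "?L = (\<Sum>a\<in>B. \<Sum>b\<in>B. \<Sum>X\<in>Pow A. \<Sum>Y\<in>Pow A.
           noise_kernel A X Y * (p a (sym_diff X (h a)) * q b (sym_diff Y (h b))))"
    using sum_Pow_sym_diff_pairs[of B h A "\<lambda>a b X Y.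
      noise_kernel A X Y * (p a (sym_diff X (h a)) * q b (sym_diff Y (h b)))", OF h]
    by (simp only: inv)
  also have "\<dots> = (\<Sum>X\<in>Pow A. \<Sum>Y\<in>Pow A. noise_kernel A X Y * (F p X * F q Y))"
    unfolding F_def sum_product unfolding sum_distrib_left by (rule sum_swap_pairs)
  also have "\<dots> = 4 ^ card A * (\<Sum>S\<in>Pow A. fourier A (F p) S * fourier A (F q) S / 3 ^ card S)"
    by (rule sum_noise_kernel[OF A])
  finally have L: "?L = \<dots>" .
  \<comment> \<open>The inequality between arithmetic and geometric means decouples the two
    sites.\<close>
  have "\<bar>\<Sum>S\<in>Pow A. fourier A (F p) S * fourier A (F q) S / 3 ^ card S\<bar> \<le>
          (\<Sum>S\<in>Pow A. ((fourier A (F p) S)\<^sup>2 / 3 ^ card S + (fourier A (F q) S)\<^sup>2 / 3 ^ card S) / 2)"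
  proof (rule order_trans[OF sum_abs sum_mono])
    fix S
    have "\<bar>x * y\<bar> \<le> (x\<^sup>2 + y\<^sup>2) / 2" for x y :: real
      using sum_squares_bound[of "\<bar>x\<bar>" "\<bar>y\<bar>"] by (simp add: abs_mult)
    from divide_right_mono[OF this, of "3 ^ card S" "fourier A (F p) S" "fourier A (F q) S"]
    show "\<bar>fourier A (F p) S * fourier A (F q) S / 3 ^ card S\<bar> \<le>
      ((fourier A (F p) S)\<^sup>2 / 3 ^ card S + (fourier A (F q) S)\<^sup>2 / 3 ^ card S) / 2"
      by (simp add: abs_mult add_divide_distrib)
  qed
  also have "\<dots> \<le> sqrt (card B)"
    using bound[of p, OF p0 p1] bound[of q, OF q0 q1]
    by (simp add: sum.distrib flip: sum_divide_distrib)
  finally show ?thesis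
    unfolding L by (simp add: abs_mult)
qed

text \<open>Expanding the square gives terms \<open>w i j X * w i j Y\<close>, and
  \<open>w i j\<close> is a character of degree 0 or 2, which the kernel damps by a factor of at
  most 9.\<close>

lemma noise_game_quantum_value:
  assumes A: "finite A" and h: "\<And>a. a \<in> B \<Longrightarrow> h a \<subseteq> A"
  shows "4 ^ card A * (real (card B))\<^sup>2 * (real (card A))\<^sup>2 / 9 \<le>
    (\<Sum>X\<in>Pow A. \<Sum>Y\<in>Pow A. \<Sum>a\<in>B. \<Sum>b\<in>B.
      noise_kernel A (sym_diff X (h a)) (sym_diff Y (h b)) *
      (\<Sum>i\<in>A. walsh {i} (sym_diff X (h a)) * walsh {i} (sym_diff Y (h b)))\<^sup>2)"
proof -
  define w where "w i j X = walsh {i} X * walsh {j} X" for i j :: 'a and X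
  have term_ge: "4 ^ card A / 9 \<le> (\<Sum>X\<in>Pow A. \<Sum>Y\<in>Pow A. noise_kernel A X Y * (w i j X * w i j Y))"
    if ij: "i \<in> A" "j \<in> A" for i j
  proof -
    define S where "S = (if i = j then {} else {i, j})"
    have S: "S \<in> Pow A" "card S \<le> 2" and wS: "walsh S X = w i j X" for X
      using ij by (auto simp: S_def w_def walsh_insert walsh_singleton)
    have "fourier A (w i j) S = 1"
      using A by (simp add: fourier_def card_Pow flip: wS)
    \<comment> \<open>All terms are squares over positive weights, so the single term at
      \<open>S\<close> is a lower bound.\<close>
    then have "1 / 3 ^ card S \<le> (\<Sum>S\<in>Pow A. fourier A (w i j) S * fourier A (w i j) S / 3 ^ card S)"
      using member_le_sum[OF S(1), of "\<lambda>S. fourier A (w i j) S * fourier A (w i j) S / 3 ^ card S"] A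
      by simp
    moreover have "(3::real) ^ card S \<le> 3 ^ 2"
      using S(2) by (rule power_increasing) simp
    then have "(1::real) / 9 \<le> 1 / 3 ^ card S"
      by (intro divide_left_mono) auto
    ultimately have "1 / 9 \<le> (\<Sum>S\<in>Pow A. fourier A (w i j) S * fourier A (w i j) S / 3 ^ card S)"
      by linarith
    then show ?thesis
      unfolding sum_noise_kernel[OF A] by simp
  qed
  have value_le: "4 ^ card A * (real (card A))\<^sup>2 / 9 \<le>
      (\<Sum>X\<in>Pow A. \<Sum>Y\<in>Pow A. noise_kernel A X Y * (\<Sum>i\<in>A. walsh {i} X * walsh {i} Y)\<^sup>2)"
  proof -
    have "4 ^ card A * (real (card A))\<^sup>2 / 9 = (\<Sum>i\<in>A. \<Sum>j\<in>A. 4 ^ card A / 9)"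
      by (simp add: power2_eq_square)
    also have "\<dots> \<le> (\<Sum>i\<in>A. \<Sum>j\<in>A. \<Sum>X\<in>Pow A. \<Sum>Y\<in>Pow A. noise_kernel A X Y * (w i j X * w i j Y))"
      by (intro sum_mono term_ge)
    also have "\<dots> = (\<Sum>X\<in>Pow A. \<Sum>Y\<in>Pow A. \<Sum>i\<in>A. \<Sum>j\<in>A. noise_kernel A X Y * (w i j X * w i j Y))"
      by (rule sum_swap_pairs)
    also have "\<dots> = (\<Sum>X\<in>Pow A. \<Sum>Y\<in>Pow A. noise_kernel A X Y * (\<Sum>i\<in>A. walsh {i} X * walsh {i} Y)\<^sup>2)"
      unfolding power2_eq_square sum_product w_def unfolding sum_distrib_left
      by (intro sum.cong refl) (simp add: mult_ac)
    finally show ?thesis .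
  qed
  have "(\<Sum>X\<in>Pow A. \<Sum>Y\<in>Pow A. \<Sum>a\<in>B. \<Sum>b\<in>B.
      noise_kernel A (sym_diff X (h a)) (sym_diff Y (h b)) *
      (\<Sum>i\<in>A. walsh {i} (sym_diff X (h a)) * walsh {i} (sym_diff Y (h b)))\<^sup>2) =
    (\<Sum>a\<in>B. \<Sum>b\<in>B. \<Sum>X\<in>Pow A. \<Sum>Y\<in>Pow A.
      noise_kernel A X Y * (\<Sum>i\<in>A. walsh {i} X * walsh {i} Y)\<^sup>2)"
    by (rule sum_Pow_sym_diff_pairs[OF h])
  also have "\<dots> = (real (card B))\<^sup>2 * (\<Sum>X\<in>Pow A. \<Sum>Y\<in>Pow A.
      noise_kernel A X Y * (\<Sum>i\<in>A. walsh {i} X * walsh {i} Y)\<^sup>2)"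
    by (simp add: power2_eq_square)
  finally show ?thesis
    using mult_left_mono[OF value_le, of "(real (card B))\<^sup>2"] by (simp add: mult_ac)
qed

subsection \<open>Sign measurements on an entangled state\<close>

text \<open>
  Sylvester's matrix: its rows and columns are indexed by \<open>Pow {..<k}\<close> and its entries are Walsh
  functions, so it inherits their orthogonality.
\<close>

lemma hadamard_exists:
  fixes k :: nat
  defines "m \<equiv> 2 ^ k"
  shows "\<exists>h :: nat \<Rightarrow> nat set. (\<forall>a. h a \<subseteq> {..<m}) \<and>
    (\<forall>i<m. \<forall>j<m. (\<Sum>a\<in>{1..m}. walsh {i} (h a) * walsh {j} (h a)) = (if i = j then real m else 0))"
proof -
  have card: "card (Pow {..<k}) = m"
    by (simp add: m_def card_Pow)
  obtain u where u: "bij_betw u {..<m} (Pow {..<k})"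
    using finite_same_card_bij[of "{..<m}" "Pow {..<k}"] card by auto
  obtain v where v: "bij_betw v {1..m} (Pow {..<k})"
    using finite_same_card_bij[of "{1..m}" "Pow {..<k}"] card by auto
  \<comment> \<open>With this set \<open>walsh {i} (h a)\<close> is the matrix entry. Coordinates
    count from 0 and outputs from 1, hence two enumerations \<open>u\<close> and
    \<open>v\<close>.\<close>
  define h where "h a = {i \<in> {..<m}. walsh (u i) (v a) = - 1}" for a
  have walsh_h: "walsh {i} (h a) = walsh (u i) (v a)" if "i < m" for i a
    using that walsh_cases[of "u i" "v a"] by (auto simp: walsh_singleton h_def)
  have "(\<Sum>a\<in>{1..m}. walsh {i} (h a) * walsh {j} (h a)) = (if i = j then real m else 0)"
    if "i < m" "j < m" for i j
  proof -
    have sub: "u i \<subseteq> {..<k}" "u j \<subseteq> {..<k}"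
      using u that unfolding bij_betw_def by auto
    have "(\<Sum>a\<in>{1..m}. walsh {i} (h a) * walsh {j} (h a)) =
            (\<Sum>a\<in>{1..m}. walsh (u i) (v a) * walsh (u j) (v a))"
      using that by (simp add: walsh_h)
    also have "\<dots> = (\<Sum>X\<in>Pow {..<k}. walsh (u i) X * walsh (u j) X)"
      by (rule sum.reindex_bij_betw[OF v])
    also have "\<dots> = (if u i = u j then 2 ^ k else 0)"
      using walsh_orthogonal[OF _ sub] by simp
    also have "\<dots> = (if i = j then real m else 0)"
      using u that by (auto simp: m_def bij_betw_def inj_on_def)
    finally show ?thesis .
  qed
  then show ?thesis
    by (intro exI[of _ h]) (auto simp: h_def)
qed

section \<open>Positive matrices and measurements\<close>

definition rank_one :: "nat \<Rightarrow> (nat \<Rightarrow> real) \<Rightarrow> complex mat" where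
  "rank_one d w = mat d d (\<lambda>(i, j). complex_of_real (w i * w j))"

lemma psd_rank_one: "psd d (rank_one d w)"
  unfolding psd_def
proof (intro conjI ballI)
  show "rank_one d w \<in> carrier_mat d d" by (simp add: rank_one_def)
  fix v :: "complex vec" assume v: "v \<in> carrier_vec d"
  define z where "z = (\<Sum>i<d. complex_of_real (w i) * v $ i)"
  have "(rank_one d w *\<^sub>v v) \<bullet>c v =
          (\<Sum>i<d. (\<Sum>j<d. complex_of_real (w i * w j) * v $ j) * cnj (v $ i))"
    using v by (auto simp: rank_one_def scalar_prod_def atLeast0LessThan intro!: sum.cong)
  also have "\<dots> = z * cnj z"
    unfolding z_def cnj_sum sum_product unfolding sum_distrib_right
    by (subst sum.swap) (auto simp: mult_ac intro!: sum.cong)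
  also have "0 \<le> \<dots>"
    by (simp add: less_eq_complex_def complex_mult_cnj)
  finally show "0 \<le> (rank_one d w *\<^sub>v v) \<bullet>c v" .
qed

lemma psd_diagonal:
  assumes "\<And>i. i < d \<Longrightarrow> 0 \<le> w i"
  shows "psd d (mat d d (\<lambda>(i, j). complex_of_real (if i = j then w i else 0)))" (is "psd d ?D")
  unfolding psd_def
proof (intro conjI ballI)
  show "?D \<in> carrier_mat d d" by simp
  fix v :: "complex vec" assume v: "v \<in> carrier_vec d"
  have "(?D *\<^sub>v v) \<bullet>c v =
          (\<Sum>i<d. (\<Sum>j<d. complex_of_real (if i = j then w i else 0) * v $ j) * cnj (v $ i))"
    using v by (auto simp: scalar_prod_def atLeast0LessThan intro!: sum.cong)
  also have "\<dots> = (\<Sum>i<d. complex_of_real (w i) * (v $ i * cnj (v $ i)))"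
  proof (intro sum.cong refl)
    fix i assume i: "i \<in> {..<d}"
    have "(\<Sum>j<d. complex_of_real (if i = j then w i else 0) * v $ j) =
            (\<Sum>j<d. if i = j then complex_of_real (w i) * v $ i else 0)"
      by (intro sum.cong refl) auto
    then show "(\<Sum>j<d. complex_of_real (if i = j then w i else 0) * v $ j) * cnj (v $ i) =
                 complex_of_real (w i) * (v $ i * cnj (v $ i))"
      using i by (simp add: mult_ac)
  qed
  also have "\<dots> = complex_of_real (\<Sum>i<d. w i * (cmod (v $ i))\<^sup>2)"
    by (simp add: complex_norm_square del: of_real_power)
  also have "0 \<le> \<dots>"
    using assms by (auto simp: less_eq_complex_def simp del: of_real_sum intro!: sum_nonneg)
  finally show "0 \<le> (?D *\<^sub>v v) \<bullet>c v" .
qed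

text \<open>Reduces the sum in the matrix module to entries, the form in which completeness of a
  measurement is checked.\<close>

lemma finsum_module_mat_index:
  fixes E :: "'c \<Rightarrow> 'a::comm_ring_1 mat"
  assumes "finite I" "\<And>a. a \<in> I \<Longrightarrow> E a \<in> carrier_mat r c" "i < r" "j < c"
  shows "finsum (module_mat TYPE('a) r c) E I \<in> carrier_mat r c"
    and "finsum (module_mat TYPE('a) r c) E I $$ (i, j) = (\<Sum>a\<in>I. E a $$ (i, j))"
proof -
  interpret abelian_group "module_mat TYPE('a) r c"
    by (rule abelian_group_mat)
  have "finsum (module_mat TYPE('a) r c) E I \<in> carrier_mat r c \<and>
        finsum (module_mat TYPE('a) r c) E I $$ (i, j) = (\<Sum>a\<in>I. E a $$ (i, j))"
    using assms(1,2)
  proof (induction I rule: finite_induct)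
    case empty
    show ?case using assms(3,4) by (simp add: module_mat_simps finsum_empty)
  next
    case (insert a I)
    have "finsum (module_mat TYPE('a) r c) E (insert a I) =
            E a + finsum (module_mat TYPE('a) r c) E I"
      using insert.hyps insert.prems by (subst finsum_insert) (auto simp: module_mat_simps)
    moreover have "E a \<in> carrier_mat r c"
      using insert.prems by simp
    ultimately show ?case
      using insert assms(3,4) by auto
  qed
  then show "finsum (module_mat TYPE('a) r c) E I \<in> carrier_mat r c"
    and "finsum (module_mat TYPE('a) r c) E I $$ (i, j) = (\<Sum>a\<in>I. E a $$ (i, j))"
    by auto
qed

lemma povmI:
  assumes "\<And>a. a \<in> {1..K} \<Longrightarrow> psd d (E a)"
    and "\<And>i j. \<lbrakk>i < d; j < d\<rbrakk> \<Longrightarrow> (\<Sum>a\<in>{1..K}. E a $$ (i, j)) = (if i = j then 1 else 0)"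
    and "d > 0"
  shows "povm d K E"
proof -
  have car: "E a \<in> carrier_mat d d" if "a \<in> {1..K}" for a
    using assms(1)[OF that] by (simp add: psd_def)
  have "finsum (module_mat TYPE(complex) d d) E {1..K} = 1\<^sub>m d"
  proof (rule eq_matI)
    show "finsum (module_mat TYPE(complex) d d) E {1..K} $$ (i, j) = 1\<^sub>m d $$ (i, j)"
      if "i < dim_row (1\<^sub>m d)" "j < dim_col (1\<^sub>m d)" for i j
      using finsum_module_mat_index(2)[of "{1..K}" E d d i j] car that assms(2) by simp
    \<comment> \<open>The carrier fact is stated for a valid entry; (0, 0) is one because
      \<open>d > 0\<close>.\<close>
    show "dim_row (finsum (module_mat TYPE(complex) d d) E {1..K}) = dim_row (1\<^sub>m d)"
      "dim_col (finsum (module_mat TYPE(complex) d d) E {1..K}) = dim_col (1\<^sub>m d)"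
      using finsum_module_mat_index(1)[of "{1..K}" E d d 0 0] car \<open>d > 0\<close> by auto
  qed
  then show ?thesis using assms(1) by (simp add: povm_def)
qed

text \<open>
  The maximally entangled state of Schmidt rank \<open>m\<close>; in a Kronecker product of \<open>n \<times> n\<close> matrices the
  basis vector \<open>e\<^sub>i \<otimes> e\<^sub>j\<close> has index \<open>i * n + j\<close>.
\<close>

definition entangled :: "nat \<Rightarrow> nat \<Rightarrow> nat \<Rightarrow> real" where
  "entangled n m s = (if s div n = s mod n \<and> s mod n < m then 1 / sqrt m else 0)"

text \<open>The vector is supported on the indices \<open>i * n + i\<close> with
  \<open>i < m\<close>.\<close>

lemma sum_entangled:
  fixes g :: "nat \<Rightarrow> complex"
  assumes "m \<le> n"
  shows "(\<Sum>s<n * n. complex_of_real (entangled n m s) * g s) =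
           (\<Sum>i<m. complex_of_real (1 / sqrt m) * g (i * n + i))"
proof -
  define f where "f i = i * n + i" for i
  have inj: "inj_on f {..<m}"
    unfolding f_def by (intro inj_onI) (metis add_mult_distrib2 mult.commute mult_Suc_right add.commute mult_cancel2 nat.distinct(1) nat_mult_1)
  have less: "f i < n * n" if "i < m" for i
  proof -
    have "f i < Suc i * n" using that assms by (simp add: f_def)
    also have "\<dots> \<le> n * n" using that assms by (intro mult_le_mono1) simp
    finally show ?thesis .
  qed
  have divmod: "f i div n = i" "f i mod n = i" if "i < m" for i
    using that assms by (simp_all add: f_def)
  have "(\<Sum>s<n * n. complex_of_real (entangled n m s) * g s) =
          (\<Sum>s\<in>f ` {..<m}. complex_of_real (entangled n m s) * g s)"
  proof (rule sum.mono_neutral_right)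
    show "\<forall>s\<in>{..<n * n} - f ` {..<m}. complex_of_real (entangled n m s) * g s = 0"
    proof
      fix s assume s: "s \<in> {..<n * n} - f ` {..<m}"
      have "s = f (s mod n)" if "s div n = s mod n"
        using div_mult_mod_eq[of s n] that by (simp add: f_def)
      then have "\<not> (s div n = s mod n \<and> s mod n < m)"
        using s by blast
      then show "complex_of_real (entangled n m s) * g s = 0"
        unfolding entangled_def by auto
    qed
  qed (use less in auto)
  also have "\<dots> = (\<Sum>i<m. complex_of_real (entangled n m (f i)) * g (f i))"
    by (simp add: sum.reindex[OF inj])
  also have "\<dots> = (\<Sum>i<m. complex_of_real (1 / sqrt m) * g (i * n + i))"
    by (intro sum.cong refl) (simp add: entangled_def divmod f_def[symmetric])
  finally show ?thesis .
qed

text \<open>The trace against \<open>rank_one\<close> is a quadratic form. Both of its indices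
  collapse by \<open>sum_entangled\<close>, and the two amplitudes \<open>1 / sqrt m\<close> combine
  to \<open>1 / m\<close>.\<close>

lemma trace_kronecker_entangled:
  assumes "A \<in> carrier_mat n n" "B \<in> carrier_mat n n" "m \<le> n"
  shows "mat_trace (kronecker A B * rank_one (n * n) (entangled n m)) =
           (\<Sum>i<m. \<Sum>j<m. A $$ (i, j) * B $$ (i, j)) / m"
proof -
  define G where "G s t = A $$ (s div n, t div n) * B $$ (s mod n, t mod n)" for s t
  have "mat_trace (kronecker A B * rank_one (n * n) (entangled n m)) =
    (\<Sum>s<n * n. \<Sum>t<n * n. G s t * complex_of_real (entangled n m t * entangled n m s))"
    using assms(1,2)
    by (auto simp: mat_trace_def kronecker_def rank_one_def scalar_prod_def G_def
        atLeast0LessThan intro!: sum.cong)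
  also have "\<dots> = (\<Sum>s<n * n. complex_of_real (entangled n m s) *
    (\<Sum>t<n * n. complex_of_real (entangled n m t) * G s t))"
    by (intro sum.cong refl) (simp add: sum_distrib_left mult_ac)
  also have "\<dots> = (\<Sum>i<m. \<Sum>j<m. complex_of_real (1 / sqrt m) * (complex_of_real (1 / sqrt m) *
    G (i * n + i) (j * n + j)))"
    unfolding sum_entangled[OF assms(3)] unfolding sum_distrib_left ..
  also have "\<dots> = (\<Sum>i<m. \<Sum>j<m. A $$ (i, j) * B $$ (i, j) / m)"
  proof (intro sum.cong refl)
    fix i j assume "i \<in> {..<m}" "j \<in> {..<m}"
    then have "G (i * n + i) (j * n + j) = A $$ (i, j) * B $$ (i, j)"
      using assms(3) by (simp add: G_def)
    moreover have "complex_of_real (1 / sqrt m) * complex_of_real (1 / sqrt m) = 1 / of_nat m"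
      by (simp flip: of_real_mult)
    ultimately show "complex_of_real (1 / sqrt m) * (complex_of_real (1 / sqrt m) *
      G (i * n + i) (j * n + j)) = A $$ (i, j) * B $$ (i, j) / m"
      by (simp only: mult.assoc[symmetric]) simp
  qed
  finally show ?thesis by (simp add: sum_divide_distrib)
qed

lemma density_operator_entangled:
  assumes "0 < m" "m \<le> n"
  shows "density_operator (n * n) (rank_one (n * n) (entangled n m))"
proof -
  have "mat_trace (rank_one (n * n) (entangled n m)) =
    (\<Sum>s<n * n. complex_of_real (entangled n m s) * complex_of_real (entangled n m s))"
    by (simp add: mat_trace_def rank_one_def)
  also have "\<dots> = (\<Sum>i<m. 1 / of_nat m)"
    unfolding sum_entangled[OF assms(2)] using assms
    by (intro sum.cong refl) (simp add: entangled_def flip: of_real_mult)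
  also have "\<dots> = 1" using assms by simp
  finally show ?thesis by (simp add: density_operator_def psd_rank_one)
qed

text \<open>
  Outcome \<open>m + 1\<close> absorbs the coordinates beyond \<open>m\<close>, which the entangled state does not see.
\<close>

definition sign_measurement :: "nat \<Rightarrow> nat \<Rightarrow> (nat \<Rightarrow> nat set) \<Rightarrow> nat \<Rightarrow> complex mat" where
  "sign_measurement n m s a =
     (if a \<le> m then rank_one n (\<lambda>i. if i < m then walsh {i} (s a) / sqrt m else 0)
      else mat n n (\<lambda>(i, j). complex_of_real (if i = j then of_bool (a = m + 1 \<and> m \<le> i) else 0)))"

text \<open>Orthogonality yields the identity on the first \<open>m\<close> coordinates, and outcome
  \<open>m + 1\<close> the identity on the rest, which is zero if \<open>m = n\<close>. Later
  outcomes are zero, so any \<open>K > m\<close> works.\<close>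

lemma povm_sign_measurement:
  assumes m: "0 < m" "m < K" "m \<le> n"
    and orth: "\<And>i j. \<lbrakk>i < m; j < m\<rbrakk> \<Longrightarrow>
      (\<Sum>a\<in>{1..m}. walsh {i} (s a) * walsh {j} (s a)) = (if i = j then real m else 0)"
  shows "povm n K (sign_measurement n m s)"
proof (rule povmI)
  show "psd n (sign_measurement n m s a)" for a
    unfolding sign_measurement_def by (auto intro!: psd_rank_one psd_diagonal)
  fix i j assume ij: "i < n" "j < n"
  define e where "e a = sign_measurement n m s a $$ (i, j)" for a
  have "(\<Sum>a\<in>{1..K}. e a) = (\<Sum>a\<in>{1..m}. e a) + (\<Sum>a\<in>{m<..K}. e a)"
    using m by (subst sum.union_disjoint[symmetric]) (auto intro!: sum.cong)
  also have "(\<Sum>a\<in>{m<..K}. e a) = (\<Sum>a\<in>{m<..K}. if a = m + 1 then of_bool (i = j \<and> m \<le> i) else 0)"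
    using ij by (intro sum.cong refl) (auto simp: e_def sign_measurement_def)
  also have "\<dots> = of_bool (i = j \<and> m \<le> i)"
    using m by simp
  also have "(\<Sum>a\<in>{1..m}. e a) = of_bool (i = j \<and> i < m)"
  proof (cases "i < m \<and> j < m")
    case True
    have "(\<Sum>a\<in>{1..m}. e a) =
      complex_of_real ((\<Sum>a\<in>{1..m}. walsh {i} (s a) * walsh {j} (s a)) / m)"
      using ij True by (simp add: e_def sign_measurement_def rank_one_def sum_divide_distrib
          flip: of_real_mult)
    also have "\<dots> = of_bool (i = j \<and> i < m)"
      using True m orth by simp
    finally show ?thesis .
  next
    case False
    then show ?thesis
      using ij by (auto simp: e_def sign_measurement_def rank_one_def)
  qed
  finally show "(\<Sum>a\<in>{1..K}. sign_measurement n m s a $$ (i, j)) = (if i = j then 1 else 0)"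
    by (auto simp: e_def)
qed (use m in simp)

lemma sign_measurement_carrier: "sign_measurement n m s a \<in> carrier_mat n n"
  by (simp add: sign_measurement_def rank_one_def)

lemma sign_measurement_Reals:
  "\<lbrakk>i < n; j < n\<rbrakk> \<Longrightarrow> sign_measurement n m s a $$ (i, j) \<in> \<real>"
  by (simp add: sign_measurement_def rank_one_def)

subsection \<open>The violation\<close>

text \<open>Each response is at most 1, being one of several nonnegative numbers with sum 1, so the
  product is bounded on a probability space.\<close>

lemma integrable_response_product:
  assumes "prob_space W" "response W N K p" "response W N K q"
    and "a \<in> {1..K}" "b \<in> {1..K}" "x \<in> {1..N}" "y \<in> {1..N}"
  shows "integrable W (\<lambda>\<omega>. p \<omega> a x * q \<omega> b y)"
proof -
  interpret prob_space W by fact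
  have le1: "0 \<le> r \<omega> a x \<and> r \<omega> a x \<le> 1"
    if "response W N K r" "a \<in> {1..K}" "x \<in> {1..N}" "\<omega> \<in> space W" for r a x \<omega>
    using that member_le_sum[of a "{1..K}" "\<lambda>a. r \<omega> a x"] unfolding response_def by auto
  show ?thesis
  proof (rule integrable_const_bound[of _ 1])
    show "AE \<omega> in W. norm (p \<omega> a x * q \<omega> b y) \<le> 1"
    proof (rule AE_I2)
      fix \<omega> assume "\<omega> \<in> space W"
      then show "norm (p \<omega> a x * q \<omega> b y) \<le> 1"
        using le1[OF assms(2,4,6)] le1[OF assms(3,5,7)] by (simp add: abs_mult mult_le_one)
    qed
  qed (use assms in \<open>auto simp: response_def intro!: borel_measurable_times\<close>)
qed

text \<open>Inputs outside the encoded cube and outputs beyond \<open>m\<close> get weight zero in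
  \<open>M\<close>, so larger \<open>N\<close> and \<open>K\<close> do no harm. Dividing by the
  classical bound \<open>c\<close> makes \<open>M\<close> admissible in \<open>nu\<close>.\<close>

lemma noise_game_violation:
  fixes k n N K :: nat
  defines "m \<equiv> 2 ^ k"
  assumes mn: "m \<le> n" and mK: "m < K" and N: "2 ^ m \<le> N"
  shows "\<exists>P. quantum n n N K P \<and> ereal (sqrt (real m) / 9) \<le> nu N K P"
proof -
  define A where "A = {..<m}"
  have A: "finite A" "card A = m" by (simp_all add: A_def)
  have m: "0 < m" by (simp add: m_def)
  obtain h :: "nat \<Rightarrow> nat set" where h: "\<And>a. h a \<subseteq> A"
    and orth: "\<And>i j. i < m \<Longrightarrow> j < m \<Longrightarrow>
      (\<Sum>a\<in>{1..m}. walsh {i} (h a) * walsh {j} (h a)) = (if i = j then real m else 0)"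
    using hadamard_exists[of k] unfolding m_def A_def by blast
  obtain enc where enc: "enc ` Pow A \<subseteq> {1..N}" "inj_on enc (Pow A)"
    using card_le_inj[of "Pow A" "{1..N}"] N A by (auto simp: card_Pow)
  define C where "C = enc ` Pow A"
  define dec where "dec = inv_into (Pow A) enc"
  have dec: "dec (enc X) = X" if "X \<in> Pow A" for X
    using enc(2) that by (simp add: dec_def)
  have encN: "enc X \<in> {1..N}" if "X \<in> Pow A" for X
    using enc(1) that by blast
  define s where "s x a = sym_diff (dec x) (h a)" for x a
  define E where "E x = sign_measurement n m (s x)" for x
  \<comment> \<open>The real part only adjusts the type: \<open>trace\<close> shows that the number
    is real.\<close>
  define P where "P a b x y = Re ((\<Sum>i<m. \<Sum>j<m. E x a $$ (i, j) * E y b $$ (i, j)) / m)" for a b x y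
  define c where "c = 4 ^ m * sqrt (real m)"
  have c: "0 < c" using m by (simp add: c_def)
  define M where "M a b x y = (if x \<in> C \<and> y \<in> C \<and> a \<le> m \<and> b \<le> m
    then noise_kernel A (s x a) (s y b) / c else 0)" for a b x y

  \<comment> \<open>This covers \<open>x\<close> outside \<open>C\<close>, where
    \<open>dec x\<close> is an unspecified set: multiplying every \<open>h a\<close> by one fixed
    sign vector preserves orthogonality.\<close>
  have povm: "povm n K (E x)" for x
    unfolding E_def
  proof (rule povm_sign_measurement[OF m mK mn])
    fix i j assume ij: "i < m" "j < m"
    have "(\<Sum>a\<in>{1..m}. walsh {i} (s x a) * walsh {j} (s x a)) =
      walsh {i} (dec x) * walsh {j} (dec x) * (\<Sum>a\<in>{1..m}. walsh {i} (h a) * walsh {j} (h a))"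
      unfolding s_def walsh_sym_diff sum_distrib_left by (intro sum.cong refl) (simp add: mult_ac)
    also have "\<dots> = (if i = j then real m else 0)"
      using orth[OF ij] by simp
    finally show "(\<Sum>a\<in>{1..m}. walsh {i} (s x a) * walsh {j} (s x a)) = (if i = j then real m else 0)" .
  qed
  have trace: "complex_of_real (P a b x y) =
      mat_trace (kronecker (E x a) (E y b) * rank_one (n * n) (entangled n m))" for a b x y
  proof -
    have "(\<Sum>i<m. \<Sum>j<m. E x a $$ (i, j) * E y b $$ (i, j)) / of_nat m \<in> \<real>"
      unfolding E_def using mn
      by (intro Reals_divide sum_in_Reals Reals_mult sign_measurement_Reals) auto
    then have "complex_of_real (P a b x y) = (\<Sum>i<m. \<Sum>j<m. E x a $$ (i, j) * E y b $$ (i, j)) / of_nat m"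
      unfolding P_def by (rule of_real_Re)
    then show ?thesis
      using trace_kronecker_entangled[OF _ _ mn, of "E x a" "E y b"]
      by (simp only: E_def sign_measurement_carrier)
  qed
  have quantum: "quantum n n N K P"
    unfolding quantum_def using povm trace density_operator_entangled[OF m mn] by blast

  have pairing_M: "pairing N K M Q = (\<Sum>X\<in>Pow A. \<Sum>Y\<in>Pow A. \<Sum>a\<in>{1..m}. \<Sum>b\<in>{1..m}.
      noise_kernel A (sym_diff X (h a)) (sym_diff Y (h b)) * Q a b (enc X) (enc Y)) / c" for Q
  proof -
    have outputs: "(\<Sum>a\<in>{1..K}. \<Sum>b\<in>{1..K}. M a b x y * Q a b x y) =
        (\<Sum>a\<in>{1..m}. \<Sum>b\<in>{1..m}. M a b x y * Q a b x y)" for x y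
    proof -
      have "(\<Sum>a\<in>{1..K}. \<Sum>b\<in>{1..K}. M a b x y * Q a b x y) =
          (\<Sum>a\<in>{1..m}. \<Sum>b\<in>{1..K}. M a b x y * Q a b x y)"
        using mK by (intro sum.mono_neutral_right) (auto simp: M_def)
      also have "\<dots> = (\<Sum>a\<in>{1..m}. \<Sum>b\<in>{1..m}. M a b x y * Q a b x y)"
        using mK by (intro sum.cong refl sum.mono_neutral_right) (auto simp: M_def)
      finally show ?thesis .
    qed
    have "pairing N K M Q = (\<Sum>x\<in>C. \<Sum>y\<in>{1..N}. \<Sum>a\<in>{1..m}. \<Sum>b\<in>{1..m}. M a b x y * Q a b x y)"
      unfolding pairing_def outputs using enc(1)
      by (intro sum.mono_neutral_right) (auto simp: M_def C_def)
    also have "\<dots> = (\<Sum>x\<in>C. \<Sum>y\<in>C. \<Sum>a\<in>{1..m}. \<Sum>b\<in>{1..m}. M a b x y * Q a b x y)"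
      using enc(1) by (intro sum.cong refl sum.mono_neutral_right) (auto simp: M_def C_def)
    also have "\<dots> = (\<Sum>X\<in>Pow A. \<Sum>Y\<in>Pow A. \<Sum>a\<in>{1..m}. \<Sum>b\<in>{1..m}.
        M a b (enc X) (enc Y) * Q a b (enc X) (enc Y))"
      unfolding C_def by (simp add: sum.reindex[OF enc(2)])
    also have "\<dots> = (\<Sum>X\<in>Pow A. \<Sum>Y\<in>Pow A. \<Sum>a\<in>{1..m}. \<Sum>b\<in>{1..m}.
        noise_kernel A (sym_diff X (h a)) (sym_diff Y (h b)) * Q a b (enc X) (enc Y) / c)"
      by (intro sum.cong refl) (simp add: M_def C_def s_def dec)
    finally show ?thesis
      by (simp add: sum_divide_distrib)
  qed

  have "\<bar>pairing N K M Q\<bar> \<le> 1" if cl: "Q \<in> classical N K" for Q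
  proof -
    obtain W :: "((nat \<Rightarrow> nat \<Rightarrow> real) \<times> (nat \<Rightarrow> nat \<Rightarrow> real)) measure" and p q
      where W: "prob_space W" and p: "response W N K p" and q: "response W N K q"
        and Q: "\<And>x y a b. x \<in> {1..N} \<Longrightarrow> y \<in> {1..N} \<Longrightarrow> a \<in> {1..K} \<Longrightarrow> b \<in> {1..K} \<Longrightarrow>
          Q a b x y = (\<integral>\<omega>. p \<omega> a x * q \<omega> b y \<partial>W)"
      using cl unfolding classical_def classical_on_def by blast
    interpret prob_space W by fact
    \<comment> \<open>The value at a fixed hidden variable. Being a finite sum it commutes with the
      integral, so a pointwise bound suffices.\<close>
    define G where "G \<omega> = (\<Sum>X\<in>Pow A. \<Sum>Y\<in>Pow A. \<Sum>a\<in>{1..m}. \<Sum>b\<in>{1..m}.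
      noise_kernel A (sym_diff X (h a)) (sym_diff Y (h b)) * (p \<omega> a (enc X) * q \<omega> b (enc Y)))" for \<omega>
    have pq: "has_bochner_integral W (\<lambda>\<omega>. p \<omega> a (enc X) * q \<omega> b (enc Y)) (Q a b (enc X) (enc Y))"
      if "X \<in> Pow A" "Y \<in> Pow A" "a \<in> {1..m}" "b \<in> {1..m}" for X Y a b
      using integrable_response_product[OF W p q, of a b "enc X" "enc Y"]
        Q[of "enc X" "enc Y" a b] encN that mK by (simp add: has_bochner_integral_iff)
    have hasG: "has_bochner_integral W G (\<Sum>X\<in>Pow A. \<Sum>Y\<in>Pow A. \<Sum>a\<in>{1..m}. \<Sum>b\<in>{1..m}.
      noise_kernel A (sym_diff X (h a)) (sym_diff Y (h b)) * Q a b (enc X) (enc Y))"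
      unfolding G_def by (intro has_bochner_integral_sum has_bochner_integral_mult_right pq)
    then have intG: "integrable W G" and pairing: "pairing N K M Q = integral\<^sup>L W G / c"
      unfolding pairing_M by (auto simp: has_bochner_integral_iff)
    have G: "\<bar>G \<omega>\<bar> \<le> c" if \<omega>: "\<omega> \<in> space W" for \<omega>
    proof -
      have resp: "0 \<le> r \<omega> a (enc X)" "(\<Sum>a\<in>{1..m}. r \<omega> a (enc X)) \<le> 1"
        if r: "response W N K r" and X: "X \<subseteq> A" and a: "a \<in> {1..m}" for r a X
      proof -
        have x: "enc X \<in> {1..N}" using X encN by simp
        show "0 \<le> r \<omega> a (enc X)"
          using r x a mK \<omega> unfolding response_def by auto
        have "(\<Sum>a\<in>{1..m}. r \<omega> a (enc X)) \<le> (\<Sum>a\<in>{1..K}. r \<omega> a (enc X))"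
          using r x mK \<omega> unfolding response_def by (intro sum_mono2) auto
        then show "(\<Sum>a\<in>{1..m}. r \<omega> a (enc X)) \<le> 1"
          using r x \<omega> unfolding response_def by simp
      qed
      \<comment> \<open>The second fact in \<open>resp\<close> does not depend on the output; output
        1 discharges its premise.\<close>
      have 1: "1 \<in> {1..m}" using m by simp
      show ?thesis
        using noise_game_classical_bound[of A "{1..m}" h "\<lambda>a X. p \<omega> a (enc X)" "\<lambda>a X. q \<omega> a (enc X)"]
          A h resp(1)[OF p] resp(2)[OF p _ 1] resp(1)[OF q] resp(2)[OF q _ 1]
        unfolding G_def c_def by simp
    qed
    have "integral\<^sup>L W G \<le> c"
      by (rule integral_le_const[OF intG]) (use G in \<open>force simp: abs_le_iff\<close>)
    moreover have "- c \<le> integral\<^sup>L W G"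
      by (rule integral_ge_const[OF intG]) (use G in \<open>force simp: abs_le_iff\<close>)
    ultimately show ?thesis
      unfolding pairing using c by (simp add: abs_le_iff divide_le_eq)
  qed
  then have "ereal (pairing N K M P) \<le> nu N K P"
    unfolding nu_def by (intro SUP_upper) simp
  moreover have "sqrt (real m) / 9 \<le> pairing N K M P"
  proof -
    \<comment> \<open>Each of the two measurement entries carries \<open>1 / m\<close>, and the
      state another \<open>1 / m\<close>.\<close>
    have P: "P a b (enc X) (enc Y) =
        (\<Sum>i\<in>A. walsh {i} (sym_diff X (h a)) * walsh {i} (sym_diff Y (h b)))\<^sup>2 / real m ^ 3"
      if "X \<in> Pow A" "Y \<in> Pow A" "a \<in> {1..m}" "b \<in> {1..m}" for X Y a b
    proof -
      define u where "u i = walsh {i} (sym_diff X (h a)) * walsh {i} (sym_diff Y (h b))" for i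
      have entry: "E x a $$ (i, j) = complex_of_real (walsh {i} (s x a) * walsh {j} (s x a) / m)"
        if "i < m" "j < m" "a \<in> {1..m}" for x a i j
        using that mn by (simp add: E_def sign_measurement_def rank_one_def flip: of_real_mult)
      have "(\<Sum>i<m. \<Sum>j<m. E (enc X) a $$ (i, j) * E (enc Y) b $$ (i, j)) / of_nat m =
          (\<Sum>i<m. \<Sum>j<m. complex_of_real (u i * u j / m\<^sup>2)) / of_nat m"
        using that by (intro arg_cong2[where f = "(/)"] sum.cong refl)
          (simp add: entry s_def dec u_def power2_eq_square)
      also have "\<dots> = complex_of_real ((\<Sum>i<m. \<Sum>j<m. u i * u j / m\<^sup>2) / m)"
        by simp
      finally have "P a b (enc X) (enc Y) = (\<Sum>i<m. \<Sum>j<m. u i * u j / m\<^sup>2) / m"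
        unfolding P_def by (simp only: Re_complex_of_real)
      also have "\<dots> = (\<Sum>i<m. u i)\<^sup>2 / real m ^ 3"
        by (simp add: power2_eq_square[of "sum u _"] sum_product power3_eq_cube power2_eq_square
            flip: sum_divide_distrib)
      finally show ?thesis by (simp add: u_def A_def)
    qed
    define V where "V = (\<Sum>X\<in>Pow A. \<Sum>Y\<in>Pow A. \<Sum>a\<in>{1..m}. \<Sum>b\<in>{1..m}.
      noise_kernel A (sym_diff X (h a)) (sym_diff Y (h b)) *
      (\<Sum>i\<in>A. walsh {i} (sym_diff X (h a)) * walsh {i} (sym_diff Y (h b)))\<^sup>2)"
    have "pairing N K M P = V / real m ^ 3 / c"
      unfolding pairing_M V_def sum_divide_distrib
      by (intro sum.cong refl) (simp add: P)
    moreover have "4 ^ m * (real m)\<^sup>2 * (real m)\<^sup>2 / 9 \<le> V"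
      unfolding V_def using noise_game_quantum_value[of A "{1..m}" h] A h by simp
    then have "4 ^ m * (real m)\<^sup>2 * (real m)\<^sup>2 / 9 / real m ^ 3 / c \<le> V / real m ^ 3 / c"
      using c by (intro divide_right_mono) auto
    moreover have "4 ^ m * (real m)\<^sup>2 * (real m)\<^sup>2 / 9 / real m ^ 3 / c = sqrt (real m) / 9"
      using m by (simp add: c_def field_simps power2_eq_square power3_eq_cube)
    ultimately show ?thesis by (simp only:)
  qed
  ultimately show ?thesis
    using quantum by (meson ereal_less_eq(3) order_trans)
qed

section \<open>Choice of the parameters\<close>

lemma least_nat_above_ge: "x \<le> real (least_nat_above x)"
  unfolding least_nat_above_def by (rule LeastI_ex) (rule real_arch_simple)

theorem corollary1:
  shows "\<exists>c::real. c > 0 \<and> (\<forall>n::nat. n \<ge> 2 \<longrightarrow>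
    (\<exists>P :: family.
       quantum n n (least_nat_above (2 powr ((log 2 (real n))\<^sup>2 / 2)) ^ n) (n + 1) P \<and>
       nu (least_nat_above (2 powr ((log 2 (real n))\<^sup>2 / 2)) ^ n) (n + 1) P
         \<ge> ereal (c * (sqrt (real n) / (log 2 (real n))\<^sup>2))))"
proof (intro exI[of _ "1 / 18"] conjI allI impI)
  fix n :: nat assume n: "2 \<le> n"
  define N where "N = least_nat_above (2 powr ((log 2 (real n))\<^sup>2 / 2))"
  \<comment> \<open>The bound \<open>n < 2 * 2 ^ k\<close> costs less than a factor 2 under the
    square root, which turns 1/9 into 1/18.\<close>
  obtain k where k: "2 ^ k \<le> n" "n < 2 ^ (k + 1)"
    using ex_power_ivl1[of 2 n] n by auto
  have log: "1 \<le> log 2 (real n)"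
    using n by (simp add: le_log_iff)
  \<comment> \<open>A positive exponent gives \<open>N \<ge> 2\<close>, so the \<open>N ^ n\<close>
    inputs accommodate all sign vectors of length \<open>2 ^ k\<close>.\<close>
  then have "1 < 2 powr ((log 2 (real n))\<^sup>2 / 2)"
    by (intro gr_one_powr) auto
  then have "1 < real N"
    using least_nat_above_ge unfolding N_def by (rule less_le_trans)
  then have "(2::nat) ^ n \<le> N ^ n"
    by (intro power_mono) auto
  moreover have "(2::nat) ^ 2 ^ k \<le> 2 ^ n"
    using k(1) by (intro power_increasing) auto
  ultimately have "(2::nat) ^ 2 ^ k \<le> N ^ n"
    by (rule order_trans[rotated])
  then obtain P where P: "quantum n n (N ^ n) (n + 1) P"
    and nu: "ereal (sqrt (real (2 ^ k)) / 9) \<le> nu (N ^ n) (n + 1) P"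
    using noise_game_violation[of k n "n + 1" "N ^ n"] k(1) by auto
  \<comment> \<open>Dividing by the squared logarithm only lowers the value, as the logarithm is at
    least 1.\<close>
  have "sqrt (real n) / (log 2 (real n))\<^sup>2 \<le> sqrt (real n)"
    using log divide_left_mono[of 1 "(log 2 (real n))\<^sup>2" "sqrt (real n)"] by simp
  also have "\<dots> \<le> sqrt (4 * real (2 ^ k))"
    using of_nat_mono[OF less_imp_le[OF k(2)], where 'a = real] by simp
  also have "\<dots> = 2 * sqrt (real (2 ^ k))"
    by (simp only: real_sqrt_mult real_sqrt_four)
  finally have "1 / 18 * (sqrt (real n) / (log 2 (real n))\<^sup>2) \<le> sqrt (real (2 ^ k)) / 9"
    by simp
  with P nu show "\<exists>P :: family.
       quantum n n (least_nat_above (2 powr ((log 2 (real n))\<^sup>2 / 2)) ^ n) (n + 1) P \<and>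
       nu (least_nat_above (2 powr ((log 2 (real n))\<^sup>2 / 2)) ^ n) (n + 1) P
         \<ge> ereal (1 / 18 * (sqrt (real n) / (log 2 (real n))\<^sup>2))"
    unfolding N_def by (meson ereal_less_eq(3) order_trans)
qed simp

end
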